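(* Let $L:[1,\infty)\to[1,\infty)$ be any function. For every integer $r\ge2$ and every $\delta>0$, with $K=r^2$, there are an integer $n$ and a nonempty set $S\subseteq\mathbb F_2^n$ such that $$E(S)\ge K^{-1}|S|^3$$ and every nonempty $Y\subseteq S$ with $|Y+Y|\le L(K)|Y|$ satisfies $$|Y|\le(1+\delta)K^{-1/2}|S|.$$ Consequently, let $\gamma:[1,\infty)\to[0,1]$ be any function such that, for every $K\ge1$, every $n\geq 1$ and every nonempty $B\subseteq\mathbb F_2^n$ with $E(B)\ge K^{-1}|B|^3$, there is a nonempty $Y\subseteq B$ with $|Y+Y|\le L(K)|Y|$ and $|Y|\ge\gamma(K)|B|$. Let $K=r^2$ with $r\geq 2$ an integer, let $\eta\ge0$, and suppose there is a constant $c>0$ such that $|A\cap Y|\ge c|A|$ holds for all $n\ge 1$ and all $A,B,Y\subseteq\mathbb F_2^n$ with $A\ne\varnothing$, $Y\subseteq B$, $|Y|\ge\gamma(K)|B|$ and $|A\triangle B|\le\eta|A|$. Then $$\eta<\frac1{\sqrt K-1}.$$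
   Context: For $S,T\subseteq\mathbb F_2^n$, $S+T=\{s+t:s\in S,t\in T\}$; $\triangle$ is symmetric difference. The additive energy of a nonempty $S\subseteq\mathbb F_2^n$ is $E(S)=|\{(x_1,x_2,x_3,x_4)\in S^4:x_1+x_2=x_3+x_4\}|$. *)

theory Defs
  imports
    Complex_Main
    "HOL-Library.Z2"
    "HOL-Library.Set_Algebras"
    "Jordan_Normal_Form.Matrix"
begin

text \<open>
  Vectors over the two-element field \<^typ>\<open>bit\<close> are the vectors of the Jordan normal form
  development, whose dimension is a term. Sumsets \<open>S + T\<close> are those of
  \<^theory>\<open>HOL-Library.Set_Algebras\<close>, and symmetric differences are written with
  \<^term>\<open>sym_diff\<close>.
\<close>

abbreviation F2_space :: "nat \<Rightarrow> bit vec set" where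
  "F2_space n \<equiv> carrier_vec n"

definition additive_energy :: "'a::plus set \<Rightarrow> nat" where
  "additive_energy S =
     card {(x1, x2, x3, x4). x1 \<in> S \<and> x2 \<in> S \<and> x3 \<in> S \<and> x4 \<in> S \<and> x1 + x2 = x3 + x4}"

end

theory Submission
  imports Defs
begin

text \<open>
  The set \<open>S\<close> is a disjoint union of \<open>r\<close> affine subspaces of equal size \<open>N\<close> in general position.
  Each contributes \<open>N\<^sup>3\<close> additive quadruples, so the energy is at least
  \<open>r N\<^sup>3 = |S|\<^sup>3 / r\<^sup>2\<close>. The sum of two points from different pieces determines both points, so
  if \<open>Y\<close> has small doubling, then the product of the sizes of any two pieces of \<open>Y\<close> is
  \<open>O(|Y|)\<close>; all pieces but the largest thus have bounded size and \<open>|Y| \<le> N + O(1)\<close>.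
  Hence \<open>\<gamma>(K) \<le> 1 / r\<close>, so a single point \<open>Y\<close> of an \<open>r\<close>-element set \<open>B\<close> is admissible, and
  \<open>A = B - Y\<close> misses \<open>Y\<close> although \<open>|A \<triangle> B| = |A| / (r - 1)\<close>.
\<close>

section \<open>Energy and doubling for disjoint unions\<close>

text \<open>Any triple inside one piece extends, by \<open>closed\<close>, to an additive quadruple
  inside the same piece, so a piece \<open>V i\<close> yields \<open>card (V i) ^ 3\<close>
  quadruples. Quadruples across pieces are simply discarded.\<close>

lemma additive_energy_UN_ge:
  fixes V :: "'i \<Rightarrow> 'a::plus set"
  assumes "finite I" and fin: "\<And>i. i \<in> I \<Longrightarrow> finite (V i)"
    and disj: "disjoint_family_on V I"
    and closed: "\<And>i x y z. i \<in> I \<Longrightarrow> x \<in> V i \<Longrightarrow> y \<in> V i \<Longrightarrow> z \<in> V i \<Longrightarrow> \<exists>w\<in>V i. x + y = z + w"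
  shows "(\<Sum>i\<in>I. card (V i) ^ 3) \<le> additive_energy (\<Union>i\<in>I. V i)"
proof -
  let ?S = "\<Union>i\<in>I. V i"
  let ?Q = "{(x1, x2, x3, x4). x1 \<in> ?S \<and> x2 \<in> ?S \<and> x3 \<in> ?S \<and> x4 \<in> ?S \<and> x1 + x2 = x3 + x4}"
  let ?T = "SIGMA i:I. V i \<times> V i \<times> V i"
  obtain w where w: "\<And>i x y z. i \<in> I \<Longrightarrow> x \<in> V i \<Longrightarrow> y \<in> V i \<Longrightarrow> z \<in> V i \<Longrightarrow>
      w i x y z \<in> V i \<and> x + y = z + w i x y z"
    using closed by metis
  \<comment> \<open>The index \<open>i\<close> is dropped from the image but can be recovered from
    \<open>x\<close>, since the pieces are disjoint.\<close>
  let ?f = "\<lambda>(i, x, y, z). (x, y, z, w i x y z)"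
  have "inj_on ?f ?T"
    using disj by (auto simp: inj_on_def disjoint_family_on_def)
  moreover have "?f ` ?T \<subseteq> ?Q"
    using w by auto blast+
  moreover have "finite ?Q"
    by (rule finite_subset[of _ "?S \<times> ?S \<times> ?S \<times> ?S"]) (use assms(1) fin in auto)
  ultimately have "card ?T \<le> card ?Q"
    by (rule card_inj_on_le)
  moreover have "card ?T = (\<Sum>i\<in>I. card (V i) ^ 3)"
    using assms(1) fin by (simp add: card_SigmaI card_cartesian_product power3_eq_cube mult.assoc)
  ultimately show ?thesis
    by (simp add: additive_energy_def)
qed

lemma card_set_plus_inj:
  fixes A B :: "'a::plus set"
  assumes "inj_on (\<lambda>(a, b). a + b) (A \<times> B)"
  shows "card (A + B) = card A * card B"
  using card_image[OF assms] by (simp add: set_plus_image card_cartesian_product)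

text \<open>The largest piece of \<open>Y\<close> has at least \<open>card Y / card I\<close>
  points. Its sumset with any other piece has the full product size and lies in
  \<open>Y + Y\<close>, so dividing by the size of the largest piece bounds every other piece by
  \<open>card I * C\<close>.\<close>

lemma card_le_of_small_doubling:
  fixes V :: "'i \<Rightarrow> 'a::plus set" and C :: real
  assumes I: "finite I" "I \<noteq> {}" and fin: "\<And>i. i \<in> I \<Longrightarrow> finite (V i)"
    and disj: "disjoint_family_on V I"
    and inj: "\<And>i j. i \<in> I \<Longrightarrow> j \<in> I \<Longrightarrow> i \<noteq> j \<Longrightarrow> inj_on (\<lambda>(a, b). a + b) (V i \<times> V j)"
    and N: "\<And>i. i \<in> I \<Longrightarrow> card (V i) \<le> N"
    and Y: "Y \<subseteq> (\<Union>i\<in>I. V i)" "Y \<noteq> {}"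
    and dbl: "real (card (Y + Y)) \<le> C * real (card Y)" and "0 \<le> C"
  shows "real (card Y) \<le> real N + (real (card I))\<^sup>2 * C"
proof -
  let ?y = "\<lambda>i. card (Y \<inter> V i)"
  have finY: "finite Y"
    using Y(1) I(1) fin by (meson finite_UN finite_subset)
  have Y_eq: "Y = (\<Union>i\<in>I. Y \<inter> V i)"
    using Y(1) by auto
  have "card (\<Union>i\<in>I. Y \<inter> V i) = (\<Sum>i\<in>I. ?y i)"
    using I(1) finY disj by (intro card_UN_disjoint) (auto simp: disjoint_family_on_def)
  with Y_eq have cardY: "card Y = (\<Sum>i\<in>I. ?y i)"
    by simp
  obtain i where i: "i \<in> I" and max: "\<And>j. j \<in> I \<Longrightarrow> ?y j \<le> ?y i"
    using obtains_MAX[OF I, of ?y] I(1) by (metis Max_ge finite_imageI imageI)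
  have le_max: "card Y \<le> card I * ?y i"
    unfolding cardY using sum_bounded_above[of I ?y "?y i"] max by simp
  have "card Y > 0"
    using Y(2) finY by (simp add: card_gt_0_iff)
  with le_max have pos: "?y i > 0"
    by (cases "?y i") auto
  have small: "real (?y j) \<le> real (card I) * C" if "j \<in> I - {i}" for j
  proof -
    have "card ((Y \<inter> V i) + (Y \<inter> V j)) = ?y i * ?y j"
      by (intro card_set_plus_inj inj_on_subset[OF inj[of i j]]) (use i that in auto)
    moreover have "card ((Y \<inter> V i) + (Y \<inter> V j)) \<le> card (Y + Y)"
      using finY by (intro card_mono finite_set_plus set_plus_mono2) auto
    ultimately have "real (?y i) * real (?y j) \<le> real (card (Y + Y))"
      by (metis of_nat_le_iff of_nat_mult)
    also note dbl
    \<comment> \<open>Trading \<open>card Y\<close> for a multiple of \<open>?y i\<close> puts the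
      factor \<open>?y i\<close> on both sides, where it cancels.\<close>
    also have "C * real (card Y) \<le> C * (real (card I) * real (?y i))"
      using le_max \<open>0 \<le> C\<close> by (intro mult_left_mono) (metis of_nat_le_iff of_nat_mult)+
    finally have "real (?y i) * real (?y j) \<le> real (?y i) * (real (card I) * C)"
      by (simp add: algebra_simps)
    with pos show ?thesis
      by simp
  qed
  have "real (card Y) = real (?y i) + (\<Sum>j\<in>I - {i}. real (?y j))"
    unfolding cardY using i I(1) by (simp add: sum.remove)
  also have "\<dots> \<le> real N + (\<Sum>j\<in>I - {i}. real (card I) * C)"
  proof (intro add_mono sum_mono)
    have "?y i \<le> card (V i)"
      using fin i by (intro card_mono) auto
    with N[OF i] show "real (?y i) \<le> real N"
      by simp
  qed (use small in auto)
  \<comment> \<open>Counting the index \<open>i\<close> once more only weakens the bound and gives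
    the tidy factor \<open>(card I)\<^sup>2\<close>.\<close>
  also have "\<dots> \<le> real N + (\<Sum>j\<in>I. real (card I) * C)"
    using I(1) \<open>0 \<le> C\<close> by (intro add_left_mono sum_mono2) auto
  finally show ?thesis
    by (simp add: power2_eq_square mult.assoc)
qed

section \<open>Affine subspaces supported on disjoint coordinate blocks\<close>

text \<open>
  The marked coordinate \<open>i * m\<close> makes the cosets of different blocks disjoint; the corresponding
  subspaces would share the zero vector.
\<close>

definition block_coset :: "nat \<Rightarrow> nat \<Rightarrow> nat \<Rightarrow> bit vec set" where
  "block_coset n m i =
     {v \<in> carrier_vec n. v $ (i * m) = 1 \<and> (\<forall>k<n. v $ k = 1 \<longrightarrow> k div m = i)}"

lemma block_coset_index_eq_0:
  assumes "v \<in> block_coset n m i" "k < n" "k div m \<noteq> i"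
  shows "v $ k = 0"
  using assms by (auto simp: block_coset_def simp flip: bit_not_one_iff)

lemma block_coset_closed:
  assumes "i * m < n" "x \<in> block_coset n m i" "y \<in> block_coset n m i" "z \<in> block_coset n m i"
  shows "\<exists>w\<in>block_coset n m i. x + y = z + w"
proof
  \<comment> \<open>A sum of three elements keeps the marked coordinate, as 1 + 1 + 1 = 1 in
    characteristic two; for the same reason adding \<open>z\<close> again cancels it.\<close>
  show "x + y + z \<in> block_coset n m i"
    using assms by (auto simp: block_coset_def)
  have "c + (a + b + c) = a + b" for a b c :: bit
    by (cases a; cases b; cases c) simp_all
  with assms show "x + y = z + (x + y + z)"
    unfolding block_coset_def by (intro eq_vecI) auto
qed

text \<open>The two supports lie in different blocks, so at each coordinate one summand vanishes and
  the sum reveals the other.\<close>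

lemma block_coset_plus_inj:
  assumes "i \<noteq> j"
  shows "inj_on (\<lambda>(a, b). a + b) (block_coset n m i \<times> block_coset n m j)"
proof -
  have "a = a' \<and> b = b'"
    if mem: "a \<in> block_coset n m i" "a' \<in> block_coset n m i"
      "b \<in> block_coset n m j" "b' \<in> block_coset n m j" and eq: "a + b = a' + b'" for a a' b b'
  proof -
    have coord: "a $ k = a' $ k \<and> b $ k = b' $ k" if "k < n" for k
    proof -
      have "a $ k + b $ k = a' $ k + b' $ k"
        using arg_cong[OF eq, of "\<lambda>v. v $ k"] mem that by (auto simp: block_coset_def)
      moreover have "(a $ k = 0 \<and> a' $ k = 0) \<or> (b $ k = 0 \<and> b' $ k = 0)"
        using block_coset_index_eq_0 mem that assms by (cases "k div m = i") auto
      ultimately show ?thesis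
        by (elim disjE conjE) (simp_all only: add_0_left add_0_right simp_thms)
    qed
    show ?thesis
      using mem coord by (auto simp: block_coset_def intro!: eq_vecI)
  qed
  then show ?thesis
    by (auto simp: inj_on_def)
qed

lemma card_block_coset:
  assumes "i < r"
  shows "card (block_coset (r * Suc d) (Suc d) i) = 2 ^ d"
proof -
  define m where "m = Suc d"
  define n where "n = r * m"
  \<comment> \<open>These are the \<open>d\<close> free coordinates of the block. A vector
    corresponds to its support within \<open>?F\<close>, the marked coordinate \<open>i * m\<close>
    being forced to 1.\<close>
  let ?F = "{i * m<..<Suc i * m}"
  let ?f = "\<lambda>X. vec n (\<lambda>k. of_bool (k \<in> insert (i * m) X)) :: bit vec"
  let ?g = "\<lambda>v. {k \<in> ?F. v $ k = (1 :: bit)}"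
  have le: "Suc i * m \<le> n"
    unfolding n_def using assms by (intro mult_le_mono1) simp
  have m: "0 < m"
    by (simp add: m_def)
  have block: "k div m = i \<longleftrightarrow> k \<in> insert (i * m) ?F" for k
  proof -
    have "k div m = i \<longleftrightarrow> i \<le> k div m \<and> k div m < Suc i"
      by auto
    also have "\<dots> \<longleftrightarrow> i * m \<le> k \<and> k < Suc i * m"
      using m by (simp only: less_eq_div_iff_mult_less_eq div_less_iff_less_mult)
    also have "\<dots> \<longleftrightarrow> k \<in> insert (i * m) ?F"
      using m by auto
    finally show ?thesis .
  qed
  have lt: "k < n" if "k \<in> insert (i * m) ?F" for k
    using that le m by auto
  have "bij_betw ?g (block_coset n m i) (Pow ?F)"
  proof (rule bij_betw_byWitness[where f' = ?f])
    show "\<forall>v\<in>block_coset n m i. ?f (?g v) = v"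
    proof (intro ballI eq_vecI)
      fix v k
      assume v: "v \<in> block_coset n m i" and "k < dim_vec v"
      then have "k < n"
        by (auto simp: block_coset_def)
      then have "k \<in> insert (i * m) ?F" if "v $ k = 1"
        using v that block[of k] by (auto simp: block_coset_def)
      with v \<open>k < n\<close> show "?f (?g v) $ k = v $ k"
        by (cases "v $ k") (auto simp: block_coset_def)
    qed (auto simp: block_coset_def)
    show "\<forall>X\<in>Pow ?F. ?g (?f X) = X"
      using lt by auto
    show "?g ` block_coset n m i \<subseteq> Pow ?F"
      by auto
    show "?f ` Pow ?F \<subseteq> block_coset n m i"
      using lt block by (auto simp: block_coset_def split: if_splits)
  qed
  then have "card (block_coset n m i) = card (Pow ?F)"
    by (rule bij_betw_same_card)
  then show ?thesis
    by (simp add: card_Pow m_def n_def)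
qed

section \<open>The extremal set\<close>

lemma high_energy_without_large_small_doubling_subset:
  fixes C \<delta> :: real
  assumes "1 \<le> r" "0 < \<delta>" "0 \<le> C"
  shows "\<exists>n\<ge>1. \<exists>S \<subseteq> F2_space n. finite S \<and> S \<noteq> {} \<and>
           real (additive_energy S) \<ge> inverse ((real r)\<^sup>2) * (real (card S)) ^ 3 \<and>
           (\<forall>Y \<subseteq> S. Y \<noteq> {} \<and> real (card (Y + Y)) \<le> C * real (card Y) \<longrightarrow>
              real (card Y) \<le> (1 + \<delta>) * (1 / real r) * real (card S))"
proof -
  \<comment> \<open>The blocks are made so large that the additive error
    \<open>r\<^sup>2 * C\<close> is at most the fraction \<open>\<delta>\<close> of the piece size
    \<open>2 ^ d\<close>.\<close>
  obtain d where "(real r)\<^sup>2 * C / \<delta> < 2 ^ d"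
    using real_arch_pow[of 2] by auto
  then have d: "(real r)\<^sup>2 * C \<le> \<delta> * 2 ^ d"
    using assms(2) by (simp add: field_simps)
  define n where "n = r * Suc d"
  define V where "V = block_coset n (Suc d)"
  define S where "S = (\<Union>i<r. V i)"
  have card_V: "card (V i) = 2 ^ d" if "i < r" for i
    using card_block_coset[OF that] by (simp add: V_def n_def)
  have fin: "finite (V i)" if "i < r" for i
    using card_V[OF that] by (intro card_ge_0_finite) simp
  have mark: "i * Suc d < n" if "i < r" for i
    unfolding n_def using that by (simp only: mult_less_cancel2) simp
  \<comment> \<open>A common element of \<open>V i\<close> and \<open>V j\<close> is 1 at
    \<open>i * Suc d\<close>, which must then lie in block \<open>j\<close>.\<close>
  have disj: "disjoint_family_on V {..<r}"
    using mark by (fastforce simp: disjoint_family_on_def V_def block_coset_def)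
  have card_S: "card S = r * 2 ^ d"
    unfolding S_def using fin disj card_V
    by (subst card_UN_disjoint) (auto simp: disjoint_family_on_def)
  have "(\<Sum>i<r. card (V i) ^ 3) \<le> additive_energy S"
    unfolding S_def
    by (intro additive_energy_UN_ge)
      (use fin disj mark block_coset_closed in \<open>auto simp: V_def\<close>)
  then have "r * (2 ^ d) ^ 3 \<le> additive_energy S"
    using card_V by simp
  then have "real (r * (2 ^ d) ^ 3) \<le> real (additive_energy S)"
    by (rule of_nat_mono)
  then have "real (additive_energy S) \<ge> inverse ((real r)\<^sup>2) * (real (card S)) ^ 3"
    using assms(1) by (simp add: field_simps card_S power_mult_distrib power3_eq_cube power2_eq_square)
  moreover have "real (card Y) \<le> (1 + \<delta>) * (1 / real r) * real (card S)"
    if "Y \<subseteq> S" "Y \<noteq> {}" "real (card (Y + Y)) \<le> C * real (card Y)" for Y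
  proof -
    have "real (card Y) \<le> real (2 ^ d) + (real (card {..<r}))\<^sup>2 * C"
      using that assms fin disj card_V block_coset_plus_inj unfolding S_def V_def
      by (intro card_le_of_small_doubling[where V = "block_coset n (Suc d)"]) (auto simp: lessThan_empty_iff)
    also have "\<dots> \<le> (1 + \<delta>) * 2 ^ d"
      using d by (simp add: algebra_simps)
    finally show ?thesis
      using assms(1) by (simp add: card_S)
  qed
  moreover have "S \<subseteq> F2_space n"
    by (auto simp: S_def V_def block_coset_def)
  moreover have "finite S"
    by (simp add: S_def fin)
  moreover have "S \<noteq> {}"
    using card_S assms(1) by auto
  moreover have "1 \<le> n"
    using assms(1) by (simp add: n_def)
  ultimately show ?thesis
    by blast
qed

section \<open>The two claims\<close>

theorem theorem2p8:
  fixes L :: "real \<Rightarrow> real"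
  assumes L_range: "\<forall>x\<ge>1. 1 \<le> L x"
  shows
    "(\<forall>(r::nat) (\<delta>::real) (K::real). 2 \<le> r \<and> 0 < \<delta> \<and> K = (real r)\<^sup>2 \<longrightarrow>
        (\<exists>n\<ge>1. \<exists>S \<subseteq> F2_space n. S \<noteq> {} \<and>
           real (additive_energy S) \<ge> inverse K * (real (card S)) ^ 3 \<and>
           (\<forall>Y \<subseteq> S. Y \<noteq> {} \<and> real (card (Y + Y)) \<le> L K * real (card Y) \<longrightarrow>
              real (card Y) \<le> (1 + \<delta>) * K powr (- 1 / 2) * real (card S))))
     \<and>
     (\<forall>(\<gamma> :: real \<Rightarrow> real) (r::nat) (K::real) (\<eta>::real).
        (\<forall>x\<ge>1. 0 \<le> \<gamma> x \<and> \<gamma> x \<le> 1) \<and>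
        (\<forall>k\<ge>1. \<forall>n\<ge>1. \<forall>B \<subseteq> F2_space n.
           B \<noteq> {} \<and> real (additive_energy B) \<ge> inverse k * (real (card B)) ^ 3 \<longrightarrow>
           (\<exists>Y \<subseteq> B. Y \<noteq> {} \<and> real (card (Y + Y)) \<le> L k * real (card Y) \<and>
              real (card Y) \<ge> \<gamma> k * real (card B))) \<and>
        2 \<le> r \<and> K = (real r)\<^sup>2 \<and> 0 \<le> \<eta> \<and>
        (\<exists>c>0. \<forall>n\<ge>1. \<forall>A \<subseteq> F2_space n. \<forall>B \<subseteq> F2_space n. \<forall>Y \<subseteq> F2_space n.
           A \<noteq> {} \<and> Y \<subseteq> B \<and> real (card Y) \<ge> \<gamma> K * real (card B) \<and>
           real (card (sym_diff A B)) \<le> \<eta> * real (card A) \<longrightarrow>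
           real (card (A \<inter> Y)) \<ge> c * real (card A))
        \<longrightarrow> \<eta> < 1 / (sqrt K - 1))"
proof (intro conjI allI impI, goal_cases)
  case (1 r \<delta> K)
  then have "2 \<le> r" "0 < \<delta>" and K: "K = (real r)\<^sup>2"
    by auto
  then have "1 \<le> K"
    by simp
  with L_range have "0 \<le> L K"
    by force
  have K_powr: "K powr (- 1 / 2) = 1 / real r"
    using \<open>2 \<le> r\<close> by (simp add: K powr_minus_divide powr_half_sqrt)
  from \<open>2 \<le> r\<close> have "1 \<le> r"
    by simp
  from high_energy_without_large_small_doubling_subset[OF this \<open>0 < \<delta>\<close> \<open>0 \<le> L K\<close>, folded K]
  show ?case
    unfolding K_powr by blast
next
  case (2 \<gamma> r K \<eta>)
  then have r: "2 \<le> r" and K: "K = (real r)\<^sup>2"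
    and \<gamma>: "\<And>n B. n \<ge> 1 \<Longrightarrow> B \<subseteq> F2_space n \<Longrightarrow> B \<noteq> {} \<Longrightarrow>
       real (additive_energy B) \<ge> inverse K * (real (card B)) ^ 3 \<Longrightarrow>
       \<exists>Y \<subseteq> B. Y \<noteq> {} \<and> real (card (Y + Y)) \<le> L K * real (card Y) \<and>
         real (card Y) \<ge> \<gamma> K * real (card B)"
    by auto
  from 2 obtain c where "c > 0" and c: "\<And>n A B Y. n \<ge> 1 \<Longrightarrow> A \<subseteq> F2_space n \<Longrightarrow>
       B \<subseteq> F2_space n \<Longrightarrow> Y \<subseteq> F2_space n \<Longrightarrow> A \<noteq> {} \<Longrightarrow> Y \<subseteq> B \<Longrightarrow>
       real (card Y) \<ge> \<gamma> K * real (card B) \<Longrightarrow>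
       real (card (sym_diff A B)) \<le> \<eta> * real (card A) \<Longrightarrow>
       real (card (A \<inter> Y)) \<ge> c * real (card A)"
    by meson
  have "1 \<le> K"
    using r by (simp add: K)
  with L_range have LK: "0 \<le> L K"
    by force
  \<comment> \<open>The set \<open>S\<close> depends on \<open>\<delta>\<close> but
    \<open>\<gamma> K\<close> does not, so \<open>\<delta>\<close> may tend to 0 afterwards.\<close>
  have "\<gamma> K * real r \<le> 1 + \<delta>" if "\<delta> > 0" for \<delta>
  proof -
    have "1 \<le> r"
      using r by simp
    from high_energy_without_large_small_doubling_subset[OF this that LK, folded K]
    obtain n S where n: "n \<ge> 1" and S: "S \<subseteq> F2_space n" "S \<noteq> {}" "finite S"
      and E: "real (additive_energy S) \<ge> inverse K * (real (card S)) ^ 3"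
      and small: "\<forall>Y \<subseteq> S. Y \<noteq> {} \<and> real (card (Y + Y)) \<le> L K * real (card Y) \<longrightarrow>
        real (card Y) \<le> (1 + \<delta>) * (1 / real r) * real (card S)"
      by blast
    obtain Y where Y: "Y \<subseteq> S" "Y \<noteq> {}" "real (card (Y + Y)) \<le> L K * real (card Y)"
      "real (card Y) \<ge> \<gamma> K * real (card S)"
      using \<gamma>[OF n S(1,2) E] by blast
    have "real (card S) > 0"
      using S by (simp add: card_gt_0_iff)
    moreover have "\<gamma> K * real (card S) \<le> (1 + \<delta>) * (1 / real r) * real (card S)"
      using small Y by (meson order.trans)
    ultimately have "\<gamma> K \<le> (1 + \<delta>) * (1 / real r)"
      by (rule mult_right_le_imp_le[rotated])
    then show ?thesis
      using r by (simp add: field_simps)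
  qed
  then have \<gamma>_le: "\<gamma> K * real r \<le> 1"
    by (rule field_le_epsilon)
  \<comment> \<open>Unit vectors merely supply \<open>r\<close> distinct points. By
    \<open>\<gamma>_le\<close>, a single point of \<open>B\<close> is already a large enough
    \<open>Y\<close>.\<close>
  define B :: "bit vec set" where "B = unit_vec r ` {..<r}"
  define Y :: "bit vec set" where "Y = {unit_vec r 0}"
  define A where "A = B - Y"
  have "inj_on (unit_vec r :: nat \<Rightarrow> bit vec) {..<r}"
    by (intro inj_onI) simp
  then have card_B: "card B = r"
    by (simp add: B_def card_image)
  have "Y \<subseteq> B"
    using r by (auto simp: B_def Y_def)
  then have card_A: "card A = r - 1"
    by (simp add: A_def card_Diff_subset card_B Y_def)
  have "sym_diff A B = Y"
    using \<open>Y \<subseteq> B\<close> by (auto simp: A_def)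
  have carrier: "B \<subseteq> F2_space r"
    by (auto simp: B_def)
  have "A \<noteq> {}"
    using card_A r by fastforce
  show ?case
  proof (rule ccontr)
    assume "\<not> \<eta> < 1 / (sqrt K - 1)"
    \<comment> \<open>Here \<open>sqrt K - 1 = r - 1 = card A\<close>, and 1 is the size of
      \<open>sym_diff A B\<close>.\<close>
    then have "1 \<le> \<eta> * real (card A)"
      using r by (simp add: K card_A of_nat_diff field_simps)
    with \<open>sym_diff A B = Y\<close> have "real (card (sym_diff A B)) \<le> \<eta> * real (card A)"
      by (simp add: Y_def)
    then have "c * real (card A) \<le> real (card (A \<inter> Y))"
      using r carrier \<open>Y \<subseteq> B\<close> \<open>A \<noteq> {}\<close> \<gamma>_le by (intro c[of r _ B]) (auto simp: A_def card_B Y_def)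
    also have "A \<inter> Y = {}"
      by (auto simp: A_def)
    finally show False
      using \<open>c > 0\<close> card_A r by (simp add: mult_le_0_iff)
  qed
qed

end
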